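(* Let $d\ge2$ be an integer and $0<h<1$, where $h=1/N$ with $N\ge 2$ an integer and $\delta=1/N^2$. Let $$\nu^*=-\frac{1-h}{2}+\frac{1-h}{2}\sqrt{1+\frac{4h}{(1-h)^2}\Big(1-\Big(\frac{h}{h+1}\Big)^{d-1}\Big)}.$$ Let $Q_d^*=\frac1{\nu^*+1}$ and $Q_p^*=\frac{h}{\nu^*+1}Q_{p+1}^*+\frac1{\nu^*+1}$ for $1\le p\le d-1$. Set $$\mathcal S_1^*=1,\qquad \mathcal S_{p+1}^*=\frac12\Big(Q_{p+1}^*+\frac{\nu^*+1}{h}\mathcal S_p^*-\frac1h\Big),\quad 1\le p\le d-1,$$ and $\lambda_p^*=\mathcal S_p^*-\mathcal S_{p+1}^*$ for $1\le p\le d-1$, $\lambda_d^*=\mathcal S_d^*$. Then $\boldsymbol\lambda^*=(\lambda_1^*,\dots,\lambda_d^* )\in\mathbb A_h(\nu^* )$, and for $1\le p\le d$ $$\lambda_p^*=\frac{h^{d-p}}{(\nu^*+1)^{d-p+1}}+\chi_p\,\frac{\nu^*-h+\big(\frac{h}{\nu^*+1}\big)^d}{\nu^*+1-h}\Big(\frac{\nu^*+1}{2h}\Big)^{p-1},$$ where $\chi_p=\frac{2h-\nu^*-1}{2h}$ for $1\le p\le d-1$ and $\chi_d=1$. Moreover, with $\nu=\nu^*$ and $\boldsymbol\lambda=\boldsymbol\lambda^*$, for every $1\le q\le N$ the sequence $\boldsymbol E_q$ of mapped hypercube corners (defined in the context) is strictly increasing.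
   Context: Admissible set: for $h>0$ and $\nu\in(0,h)$, $\mathbb A_h(\nu)$ is the set of $\boldsymbol\lambda=(\lambda_1,\dots,\lambda_d)$ with all $\lambda_p>0$, $\sum_{p=1}^d\lambda_p=1$, and $$\lambda_1\nu>(h-\nu)\sum_{k=2}^d\lambda_k;\qquad \lambda_p\nu>\sum_{k=1}^{p-1}\lambda_k+(h-\nu)\sum_{\ell=p+1}^d\lambda_\ell,\quad 2\le p\le d$$ (empty sums are $0$). Construction of $\boldsymbol E_q$ (for given $\nu\in(0,h)$ and $\boldsymbol\lambda$ with positive entries). Let $h=1/N$, $\delta=1/N^2$, and on $[0,1]$ let $S(z)=z-\frac1{2\pi}\sin(2\pi z)$, $P(z)=z^3(6z^2-15z+10)$. Define $\phi:\mathbb R\to\mathbb R$, for every integer $j$, by $$\phi(t)=\begin{cases}jh+\nu\,S\big(\frac{t-jh}{\delta}\big),& t\in[jh,jh+\delta],\\ jh+\nu+(h-\nu)\,P\big(\frac{t-jh-\delta}{h-\delta}\big),& t\in[jh+\delta,(j+1)h].\end{cases}$$ For $1\le q\le N$ and $x\in[0,1]$ let $\psi_q(x)=\phi(x+(1-q)\delta)-\phi((1-q)\delta)$, and let $\Psi_q(\boldsymbol x)=\sum_{p=1}^d\lambda_p\psi_q(x_p)$ for $\boldsymbol x\in[0,1]^d$. Corners: the level-$q$ intervals are $I_q^j\cap[0,1]$ with $I_q^j=[jh+q\delta,(j+1)h+(q-1)\delta]$. Their endpoints are $v_q^j=\max\{jh+q\delta,0\}$ and $\tilde v_q^j=\min\{(j+1)h+(q-1)\delta,1\}$.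 The range of $j$ is $\mathcal J_q=\{-1,0,\dots,N-1\}$ for $2\le q\le N-1$, $\mathcal J_1=\{0,\dots,N-1\}$ and $\mathcal J_N=\{-1,\dots,N-2\}$ (for $q=1$, $j=-1$ and $q=N$, $j=N-1$ the interval degenerates to a point and is removed). For $\boldsymbol j=(j_1,\dots,j_d)\in\mathcal J_q^d$ the lower and upper corners of the (possibly truncated) hypercube $\prod_p (I_q^{j_p}\cap[0,1])$ are $\boldsymbol v_q^{\boldsymbol j}=(v_q^{j_1},\dots,v_q^{j_d})$ and $\tilde{\boldsymbol v}_q^{\boldsymbol j}=(\tilde v_q^{j_1},\dots,\tilde v_q^{j_d})$. Put $e_q^{\boldsymbol j}=\Psi_q(\boldsymbol v_q^{\boldsymbol j})$ and $\tilde e_q^{\boldsymbol j}=\Psi_q(\tilde{\boldsymbol v}_q^{\boldsymbol j})$. Row-major order of multi-indices: $j_1$ runs fastest, then $j_2$, and so on, $j_d$ slowest. The finite sequence $\boldsymbol E_q$ is obtained by going through $\boldsymbol j\in\mathcal J_q^d$ in row-major order and listing, for each $\boldsymbol j$, first $e_q^{\boldsymbol j}$ and then $\tilde e_q^{\boldsymbol j}$. *)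

theory Defs
  imports Complex_Main
begin

text \<open>
  A vector \<open>(x\<^sub>1, \<dots>, x\<^sub>d)\<close> is a function on \<open>nat\<close> of which only the
  values at \<open>1, \<dots>, d\<close> matter.
\<close>

definition admissible :: "nat \<Rightarrow> real \<Rightarrow> real \<Rightarrow> (nat \<Rightarrow> real) set" where
  "admissible d h \<nu> = {lam.
     (\<forall>p\<in>{1..d}. 0 < lam p) \<and>
     (\<Sum>p=1..d. lam p) = 1 \<and>
     lam 1 * \<nu> > (h - \<nu>) * (\<Sum>k=2..d. lam k) \<and>
     (\<forall>p\<in>{2..d}. lam p * \<nu> >
        (\<Sum>k=1..p-1. lam k) + (h - \<nu>) * (\<Sum>l=p+1..d. lam l))}"

definition S_step :: "real \<Rightarrow> real" where
  "S_step z = z - 1 / (2 * pi) * sin (2 * pi * z)"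

definition P_step :: "real \<Rightarrow> real" where
  "P_step z = z ^ 3 * (6 * z ^ 2 - 15 * z + 10)"

text \<open>
  The period containing \<open>t\<close> is selected by \<open>j = \<lfloor>t / h\<rfloor>\<close>.  The lemmas
  \<open>phi_left\<close> and \<open>phi_right\<close> below show that the two defining formulas then
  hold on the closed intervals, for every integer \<open>j\<close>.
\<close>

definition phi :: "real \<Rightarrow> real \<Rightarrow> real \<Rightarrow> real \<Rightarrow> real" where
  "phi h \<delta> \<nu> t = (let j = real_of_int \<lfloor>t / h\<rfloor> in
     if t \<le> j * h + \<delta>
     then j * h + \<nu> * S_step ((t - j * h) / \<delta>)
     else j * h + \<nu> + (h - \<nu>) * P_step ((t - j * h - \<delta>) / (h - \<delta>)))"

lemma phi_left:
  fixes j :: int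
  assumes "0 < \<delta>" "\<delta> < h" and t: "t \<in> {real_of_int j * h .. real_of_int j * h + \<delta>}"
  shows "phi h \<delta> \<nu> t = real_of_int j * h + \<nu> * S_step ((t - real_of_int j * h) / \<delta>)"
proof -
  have "\<lfloor>t / h\<rfloor> = j"
    using assms by (intro floor_unique) (auto simp: field_simps)
  then show ?thesis
    using t by (simp add: phi_def Let_def)
qed

lemma phi_right:
  fixes j :: int
  assumes "0 < \<delta>" "\<delta> < h"
    and t: "t \<in> {real_of_int j * h + \<delta> .. (real_of_int j + 1) * h}"
  shows "phi h \<delta> \<nu> t = real_of_int j * h + \<nu> +
    (h - \<nu>) * P_step ((t - real_of_int j * h - \<delta>) / (h - \<delta>))"
proof -
  consider "t = real_of_int j * h + \<delta>" | "t = (real_of_int j + 1) * h"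
    | "real_of_int j * h + \<delta> < t" "t < (real_of_int j + 1) * h"
    using t by fastforce
  then show ?thesis
  proof cases
    case 1
    then show ?thesis
      using phi_left[of \<delta> h t j \<nu>] assms by (simp add: S_step_def P_step_def)
  next
    case 2
    have "phi h \<delta> \<nu> t = real_of_int (j + 1) * h"
      using phi_left[of \<delta> h t "j + 1" \<nu>] assms 2 by (simp add: S_step_def)
    moreover have "P_step ((t - real_of_int j * h - \<delta>) / (h - \<delta>)) = 1"
    proof -
      have "(t - real_of_int j * h - \<delta>) / (h - \<delta>) = 1"
        using assms 2 by (simp add: field_simps)
      then show ?thesis
        by (simp only: P_step_def) simp
    qed
    ultimately show ?thesis
      by (simp add: algebra_simps)
  next
    case 3
    have "\<lfloor>t / h\<rfloor> = j"
      using assms 3 by (intro floor_unique) (auto simp: field_simps)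
    then show ?thesis
      using 3 by (simp add: phi_def Let_def)
  qed
qed

definition psi :: "real \<Rightarrow> real \<Rightarrow> real \<Rightarrow> nat \<Rightarrow> real \<Rightarrow> real" where
  "psi h \<delta> \<nu> q x = phi h \<delta> \<nu> (x + (1 - real q) * \<delta>) - phi h \<delta> \<nu> ((1 - real q) * \<delta>)"

definition Psi ::
  "nat \<Rightarrow> real \<Rightarrow> real \<Rightarrow> real \<Rightarrow> (nat \<Rightarrow> real) \<Rightarrow> nat \<Rightarrow> (nat \<Rightarrow> real) \<Rightarrow> real" where
  "Psi d h \<delta> \<nu> lam q x = (\<Sum>p=1..d. lam p * psi h \<delta> \<nu> q (x p))"

definition lower_end :: "real \<Rightarrow> real \<Rightarrow> nat \<Rightarrow> int \<Rightarrow> real" where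
  "lower_end h \<delta> q j = max (real_of_int j * h + real q * \<delta>) 0"

definition upper_end :: "real \<Rightarrow> real \<Rightarrow> nat \<Rightarrow> int \<Rightarrow> real" where
  "upper_end h \<delta> q j = min ((real_of_int j + 1) * h + (real q - 1) * \<delta>) 1"

definition index_range :: "nat \<Rightarrow> nat \<Rightarrow> int list" where
  "index_range N q =
     (if q = 1 then [0 .. int N - 1]
      else if q = N then [-1 .. int N - 2]
      else [-1 .. int N - 1])"

text \<open>
  All multi-indices \<open>(j\<^sub>1, \<dots>, j\<^sub>d)\<close> with entries from \<open>J\<close>, the component
  \<open>j\<^sub>1\<close> running fastest and \<open>j\<^sub>d\<close> slowest.
\<close>

fun row_major :: "int list \<Rightarrow> nat \<Rightarrow> (nat \<Rightarrow> int) list" where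
  "row_major J 0 = [\<lambda>_. 0]"
| "row_major J (Suc d) =
     concat (map (\<lambda>k. map (\<lambda>j. j(Suc d := k)) (row_major J d)) J)"

definition corner_values ::
  "nat \<Rightarrow> nat \<Rightarrow> real \<Rightarrow> real \<Rightarrow> real \<Rightarrow> (nat \<Rightarrow> real) \<Rightarrow> nat \<Rightarrow> real list" where
  "corner_values d N h \<delta> \<nu> lam q =
     concat (map (\<lambda>j. [Psi d h \<delta> \<nu> lam q (\<lambda>p. lower_end h \<delta> q (j p)),
                       Psi d h \<delta> \<nu> lam q (\<lambda>p. upper_end h \<delta> q (j p))])
       (row_major (index_range N q) d))"

end

theory Submission
  imports Defs
begin

text \<open>
  Let \<open>b = (\<nu> + 1) / (2 h)\<close>.  The \<open>Q\<^sub>p\<close> satisfy the admissibility conditions, written as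
  \<open>(\<nu> + 1) S\<^sub>p > 1 + h S\<^sub>p\<^sub>+\<^sub>1\<close> for the tail sums \<open>S\<^sub>p\<close>, with equality, and
  \<open>S\<^sub>p = Q\<^sub>p + (1 - Q\<^sub>1) b\<^bsup>p-1\<^esup>\<close>; since \<open>h b = (\<nu> + 1) / 2\<close>, the perturbation makes all of them strict
  as soon as \<open>Q\<^sub>1 < 1\<close>.  The quadratic equation \<open>(\<nu> + 1) (h - \<nu>) = h (h / (h + 1))\<^bsup>d-1\<^esup>\<close>
  behind \<open>\<nu>\<close> gives \<open>h - \<nu> < (h / (\<nu> + 1))\<^sup>d\<close>, which is exactly \<open>Q\<^sub>1 < 1\<close>.

  Along each axis the corner values \<open>\<psi>\<^sub>q\<close> lie in \<open>[0, 1]\<close>, every interval contributes a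
  rise in \<open>(0, h - \<nu>]\<close>, and consecutive intervals are separated by \<open>\<nu>\<close>.  When a step in
  row-major order increments component \<open>p\<close>, the value gains at least \<open>\<lambda>\<^sub>p \<nu>\<close>, loses at most
  \<open>\<lambda>\<^sub>k\<close> for each reset component \<open>k < p\<close> and at most \<open>(h - \<nu>) \<lambda>\<^sub>l\<close> for \<open>l > p\<close>.
\<close>

section \<open>Strict monotonicity of weighted sums in row-major order\<close>

lemma sorted_wrt_concat_map:
  assumes "sorted_wrt R xs"
    and "\<And>x. x \<in> set xs \<Longrightarrow> sorted_wrt Q (f x)"
    and "\<And>x y u v. \<lbrakk>x \<in> set xs; y \<in> set xs; R x y; u \<in> set (f x); v \<in> set (f y)\<rbrakk> \<Longrightarrow> Q u v"
  shows "sorted_wrt Q (concat (map f xs))"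
  using assms
proof (induction xs)
  case (Cons x xs)
  have "sorted_wrt Q (concat (map f xs))"
    by (rule Cons.IH) (use Cons.prems in \<open>simp; blast\<close>)+
  moreover have "sorted_wrt Q (f x)"
    using Cons.prems(2) by simp
  moreover have "\<forall>u\<in>set (f x). \<forall>v\<in>set (concat (map f xs)). Q u v"
    using Cons.prems(1,3) by (simp; blast)
  ultimately show ?case by (simp add: sorted_wrt_append)
qed simp

text \<open>Cuts the list into blocks, one per value of the slowest component, so that
  \<open>sorted_wrt_concat_map\<close> applies with \<open>J\<close> as the outer list.\<close>

lemma concat_map_row_major_Suc:
  "concat (map F (row_major J (Suc d))) =
     concat (map (\<lambda>k. concat (map (\<lambda>j. F (j(Suc d := k))) (row_major J d))) J)"
proof -
  have "concat (map F (concat (map g J))) = concat (map (\<lambda>k. concat (map F (g k))) J)"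
    for g :: "int \<Rightarrow> (nat \<Rightarrow> int) list"
    by (induction J) simp_all
  then show ?thesis by (simp add: o_def)
qed

lemma set_row_major:
  assumes "j \<in> set (row_major J d)" "p \<in> {1..d}"
  shows "j p \<in> set J"
  using assms by (induction d arbitrary: j) (auto simp: le_Suc_eq)

lemma sorted_row_major_sums:
  fixes L U :: "int \<Rightarrow> real" and lam :: "nat \<Rightarrow> real"
  assumes J: "sorted_wrt (<) J"
    and len: "\<And>j. j \<in> set J \<Longrightarrow> L j < U j \<and> U j - L j \<le> w"
    and range: "\<And>j. j \<in> set J \<Longrightarrow> 0 \<le> L j \<and> U j \<le> 1"
    and gap: "\<And>j k. \<lbrakk>j \<in> set J; k \<in> set J; j < k\<rbrakk> \<Longrightarrow> U j + \<nu> \<le> L k"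
    and pos: "\<And>p. p \<in> {1..n} \<Longrightarrow> 0 < lam p"
    and dom: "\<And>p. p \<in> {1..n} \<Longrightarrow>
      (\<Sum>k=1..p-1. lam k) + w * (\<Sum>l=p+1..n. lam l) < lam p * \<nu>"
    and "m \<le> n" "A \<le> B" "m = 0 \<longrightarrow> A < B" "B - A \<le> w * (\<Sum>l=m+1..n. lam l)"
  shows "sorted_wrt (<) (concat (map (\<lambda>j. [A + (\<Sum>p=1..m. lam p * L (j p)),
                                          B + (\<Sum>p=1..m. lam p * U (j p))]) (row_major J m)))"
  using assms(7-)
proof (induction m arbitrary: A B)
  case 0
  then show ?case by simp
next
  case (Suc m)
  let ?V = "\<lambda>k j. [A + lam (Suc m) * L k + (\<Sum>p=1..m. lam p * L (j p)),
                   B + lam (Suc m) * U k + (\<Sum>p=1..m. lam p * U (j p))]"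
  have lamS: "0 < lam (Suc m)" using pos Suc.prems by simp
  have tail: "(\<Sum>l=m+1..n. lam l) = lam (Suc m) + (\<Sum>l=Suc m+1..n. lam l)"
    using Suc.prems by (simp add: sum.atLeast_Suc_atMost)
  have upd: "[A + (\<Sum>p=1..Suc m. lam p * L ((j(Suc m := k)) p)),
              B + (\<Sum>p=1..Suc m. lam p * U ((j(Suc m := k)) p))] = ?V k j" for j k
  proof -
    have "(\<Sum>p=1..m. lam p * X ((j(Suc m := k)) p)) = (\<Sum>p=1..m. lam p * X (j p))"
      for X :: "int \<Rightarrow> real"
      by (rule sum.cong) auto
    then show ?thesis by simp
  qed
  have inner: "sorted_wrt (<) (concat (map (?V k) (row_major J m)))" if k: "k \<in> set J" for k
  proof (rule Suc.IH)
    have "lam (Suc m) * L k < lam (Suc m) * U k"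
      using len[OF k] lamS by simp
    then show "A + lam (Suc m) * L k \<le> B + lam (Suc m) * U k"
      "m = 0 \<longrightarrow> A + lam (Suc m) * L k < B + lam (Suc m) * U k"
      using Suc.prems by auto
    have "lam (Suc m) * (U k - L k) \<le> lam (Suc m) * w"
      using len[OF k] lamS by simp
    then show "B + lam (Suc m) * U k - (A + lam (Suc m) * L k) \<le> w * (\<Sum>l=m+1..n. lam l)"
      using Suc.prems unfolding tail by (simp add: algebra_simps)
  qed (use Suc.prems in simp)
  have outer: "u < v"
    if jk: "k \<in> set J" "k' \<in> set J" "k < k'"
      and u: "u \<in> set (concat (map (?V k) (row_major J m)))"
      and v: "v \<in> set (concat (map (?V k') (row_major J m)))" for k k' u v
  proof -
    have sum_le: "(\<Sum>p=1..m. lam p * L (j p)) \<le> (\<Sum>p=1..m. lam p)"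
      "(\<Sum>p=1..m. lam p * U (j p)) \<le> (\<Sum>p=1..m. lam p)"
      "0 \<le> (\<Sum>p=1..m. lam p * L (j p))" "0 \<le> (\<Sum>p=1..m. lam p * U (j p))"
      if "j \<in> set (row_major J m)" for j
    proof -
      have *: "0 \<le> lam p" "0 \<le> L (j p)" "L (j p) \<le> 1" "0 \<le> U (j p)" "U (j p) \<le> 1"
        if "p \<in> {1..m}" for p
        using set_row_major[OF \<open>j \<in> _\<close> that] pos[of p] that Suc.prems len[of "j p"] range[of "j p"]
        by auto
      show "(\<Sum>p=1..m. lam p * L (j p)) \<le> (\<Sum>p=1..m. lam p)"
        "(\<Sum>p=1..m. lam p * U (j p)) \<le> (\<Sum>p=1..m. lam p)"
        by (intro sum_mono mult_left_le; use * in simp)+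
      show "0 \<le> (\<Sum>p=1..m. lam p * L (j p))" "0 \<le> (\<Sum>p=1..m. lam p * U (j p))"
        by (intro sum_nonneg mult_nonneg_nonneg; use * in simp)+
    qed
    have "lam (Suc m) * L k \<le> lam (Suc m) * U k" "lam (Suc m) * L k' \<le> lam (Suc m) * U k'"
      using len[of k] len[of k'] jk lamS by auto
    then have "u \<le> B + lam (Suc m) * U k + (\<Sum>p=1..m. lam p)" "A + lam (Suc m) * L k' \<le> v"
      using u v sum_le Suc.prems by fastforce+
    moreover have "lam (Suc m) * (U k + \<nu>) \<le> lam (Suc m) * L k'"
      using gap[OF jk] lamS by simp
    ultimately show ?thesis
      using dom[of "Suc m"] Suc.prems by (simp add: algebra_simps)
  qed
  show ?case
    unfolding concat_map_row_major_Suc upd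
    by (rule sorted_wrt_concat_map[OF J]) (use inner outer in blast)+
qed

section \<open>Corner values along one axis\<close>

lemma P_step_pos: "0 < z \<Longrightarrow> 0 < P_step z"
proof -
  assume "0 < z"
  have "6 * z\<^sup>2 - 15 * z + 10 = 6 * (z - 5 / 4)\<^sup>2 + 5 / 8"
    by (simp add: power2_eq_square algebra_simps)
  then have "0 < 6 * z\<^sup>2 - 15 * z + 10"
    using zero_le_power2[of "z - 5 / 4"] by linarith
  then show ?thesis
    using \<open>0 < z\<close> by (simp add: P_step_def)
qed

lemma P_step_less_one:
  assumes "0 \<le> z" "z < 1"
  shows "P_step z < 1"
proof -
  \<comment> \<open>This is the symmetry P(1 - z) = 1 - P(z) of the smoothstep polynomial.\<close>
  have "1 - P_step z = (1 - z) ^ 3 * (6 * z\<^sup>2 + 3 * z + 1)"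
    by (simp add: P_step_def power2_eq_square power3_eq_cube algebra_simps)
  also have "\<dots> > 0"
    using assms by (intro mult_pos_pos zero_less_power add_nonneg_pos add_nonneg_nonneg) auto
  finally show ?thesis by simp
qed

lemma phi_grid:
  fixes j :: int
  assumes "0 < \<delta>" "\<delta> < h"
  shows "phi h \<delta> \<nu> (real_of_int j * h) = real_of_int j * h"
    and "phi h \<delta> \<nu> (real_of_int j * h + \<delta>) = real_of_int j * h + \<nu>"
  using phi_left[OF assms, of "real_of_int j * h" j \<nu>]
    phi_left[OF assms, of "real_of_int j * h + \<delta>" j \<nu>] assms
  by (simp_all add: S_step_def)

text \<open>The shift by \<open>(1 - q) * \<delta>\<close> moves untruncated lower ends to
  \<open>j * h + \<delta>\<close> and upper ends to \<open>(j + 1) * h\<close>, where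
  \<open>phi_grid\<close> evaluates \<open>phi\<close> exactly; such intervals rise by exactly
  \<open>h - \<nu>\<close>. Only the ends truncated at 0 and 1 require a value of
  \<open>P_step\<close>.\<close>

lemma corner_geometry:
  fixes N q :: nat and h \<delta> \<nu> :: real
  assumes N: "2 \<le> N" and h: "h = 1 / real N" and \<delta>: "\<delta> = 1 / (real N)\<^sup>2"
    and \<nu>: "0 < \<nu>" "\<nu> < h" and q: "q \<in> {1..N}"
  defines "L \<equiv> \<lambda>j. psi h \<delta> \<nu> q (lower_end h \<delta> q j)"
    and "U \<equiv> \<lambda>j. psi h \<delta> \<nu> q (upper_end h \<delta> q j)"
  shows "\<And>j. j \<in> set (index_range N q) \<Longrightarrow> L j < U j \<and> U j - L j \<le> h - \<nu>"
    and "\<And>j. j \<in> set (index_range N q) \<Longrightarrow> 0 \<le> L j \<and> U j \<le> 1"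
    and "\<And>j k. \<lbrakk>j \<in> set (index_range N q); k \<in> set (index_range N q); j < k\<rbrakk> \<Longrightarrow> U j + \<nu> \<le> L k"
proof -
  have hpos: "0 < h" and hN: "real N * h = 1" and dN: "real N * \<delta> = h" and dpos: "0 < \<delta>"
    using N by (auto simp: h \<delta> power2_eq_square)
  have "2 * \<delta> \<le> real N * \<delta>"
    using N dpos by simp
  with dN dpos have dh: "\<delta> < h" by linarith
  note grid = phi_grid[OF dpos dh, of \<nu>]
  have qd: "\<delta> \<le> real q * \<delta>" "real q * \<delta> \<le> h"
    using q dpos mult_right_mono[of "real q" "real N" \<delta>] by (auto simp: dN)

  \<comment> \<open>Relative position of \<open>(1 - q) * \<delta>\<close> in the
    \<open>P_step\<close> part of the period with index -1.\<close>
  define z where "z = (h - real q * \<delta>) / (h - \<delta>)"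
  define c where "c = phi h \<delta> \<nu> ((1 - real q) * \<delta>)"
  \<comment> \<open>Moving by whole periods keeps the relative position. The index -1 yields
    \<open>c\<close>, and \<open>N - 1\<close> yields the value at the shifted right end of the unit
    interval.\<close>
  have phi_z: "phi h \<delta> \<nu> (real_of_int i * h + (h + (1 - real q) * \<delta>)) =
      real_of_int i * h + \<nu> + (h - \<nu>) * P_step z" for i
  proof -
    have "real_of_int i * h + (h + (1 - real q) * \<delta>) \<in>
        {real_of_int i * h + \<delta>..(real_of_int i + 1) * h}"
      using qd by (simp add: algebra_simps)
    from phi_right[OF dpos dh this, of \<nu>] show ?thesis
      by (simp add: z_def algebra_simps)
  qed
  have c: "c = \<nu> - h + (h - \<nu>) * P_step z"
    using phi_z[of "-1"] by (simp add: c_def)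
  have c1: "phi h \<delta> \<nu> (1 + (1 - real q) * \<delta>) = 1 + c"
    using phi_z[of "int N - 1"] hN by (simp add: c algebra_simps)

  have z_bounds: "0 \<le> z" "z \<le> 1" using qd dh by (auto simp: z_def divide_simps)
  have z_less: "z < 1" if "q \<noteq> 1"
  proof -
    have "1 < real q" using q that by auto
    then have "\<delta> < real q * \<delta>" using dpos by simp
    then show ?thesis using dh by (simp add: z_def divide_simps)
  qed
  have z_pos: "0 < z" if "q \<noteq> N"
  proof -
    have "real q < real N" using q that by simp
    then have "real q * \<delta> < h" using dpos mult_strict_right_mono[of "real q" "real N" \<delta>] dN by simp
    then show ?thesis using dh by (simp add: z_def)
  qed
  have P01: "P_step 0 = 0" "P_step 1 = 1" by (simp_all add: P_step_def)
  have "0 \<le> P_step z" "P_step z \<le> 1"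
    using z_bounds P_step_pos[of z] P_step_less_one[of z] P01 by (cases "z = 0"; cases "z = 1"; force)+
  then have "0 \<le> (h - \<nu>) * P_step z" "(h - \<nu>) * P_step z \<le> h - \<nu>"
    using \<nu> by (auto simp: mult_left_le)
  then have c_bounds: "\<nu> - h \<le> c" "c \<le> 0"
    by (auto simp: c)
  have c_neg: "c < 0" if "q \<noteq> 1"
  proof -
    have "(h - \<nu>) * P_step z < (h - \<nu>) * 1"
      using P_step_less_one[OF z_bounds(1) z_less[OF that]] \<nu> by (intro mult_strict_left_mono) auto
    then show ?thesis by (simp add: c)
  qed
  have c_gr: "\<nu> - h < c" if "q \<noteq> N"
    using P_step_pos[OF z_pos[OF that]] \<nu> by (simp add: c)

  \<comment> \<open>The truncated intervals \<open>j = -1\<close> and \<open>j = N - 1\<close> rise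
    by \<open>- c\<close> and \<open>h - \<nu> + c\<close>. These vanish for \<open>q = 1\<close>
    and \<open>q = N\<close> respectively, exactly where the index range omits the interval.\<close>
  have J: "set (index_range N q) \<subseteq> {-1..int N - 1}"
    "-1 \<in> set (index_range N q) \<Longrightarrow> q \<noteq> 1"
    "int N - 1 \<in> set (index_range N q) \<Longrightarrow> q \<noteq> N"
    using N by (auto simp: index_range_def split: if_splits)
  have L_first: "L (-1) = 0"
    using qd by (simp add: L_def lower_end_def psi_def)
  have L_rest: "L j = real_of_int j * h + \<nu> - c" if "0 \<le> j" for j
  proof -
    have "0 \<le> real_of_int j * h" using that hpos by simp
    then have "lower_end h \<delta> q j + (1 - real q) * \<delta> = real_of_int j * h + \<delta>"
      using qd dpos by (simp add: lower_end_def algebra_simps)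
    then show ?thesis by (simp add: L_def psi_def grid c_def)
  qed
  have U_last: "U (int N - 1) = 1"
    using qd hN c1 by (simp add: U_def upper_end_def psi_def c_def algebra_simps)
  have jN: "(real_of_int j + 1) * h \<le> 1 - h" if "j \<le> int N - 2" for j
  proof -
    have "real_of_int j + 1 \<le> real N - 1" using that by linarith
    then have "(real_of_int j + 1) * h \<le> (real N - 1) * h" using hpos by simp
    then show ?thesis using hN by (simp add: algebra_simps)
  qed
  have U_rest: "U j = (real_of_int j + 1) * h - c" if "j \<le> int N - 2" for j
  proof -
    have "upper_end h \<delta> q j + (1 - real q) * \<delta> = real_of_int (j + 1) * h"
      using qd dpos jN[OF that] by (simp add: upper_end_def algebra_simps)
    then show ?thesis using grid(1)[of "j + 1"] by (simp add: U_def psi_def c_def)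
  qed

  show "L j < U j \<and> U j - L j \<le> h - \<nu>" if j: "j \<in> set (index_range N q)" for j
  proof -
    consider "j = -1" | "0 \<le> j" "j \<le> int N - 2" | "j = int N - 1"
      using j J(1) by force
    then show ?thesis
    proof cases
      case 1
      then have "U j = - c" using U_rest[of j] N by simp
      then show ?thesis using 1 L_first j J(2) c_neg c_bounds by simp
    next
      case 2
      then show ?thesis using L_rest[of j] U_rest[of j] \<nu> by (simp add: algebra_simps)
    next
      case 3
      have "L j = (real N - 1) * h + \<nu> - c"
        unfolding 3 using L_rest[of "int N - 1"] N by simp
      then have "L j = 1 - h + \<nu> - c" using hN by (simp add: algebra_simps)
      then show ?thesis using 3 U_last j J(3) c_gr c_bounds by simp
    qed
  qed
  show "0 \<le> L j \<and> U j \<le> 1" if j: "j \<in> set (index_range N q)" for j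
  proof
    show "0 \<le> L j"
    proof (cases "j = -1")
      case False
      then have "0 \<le> j" using j J(1) by force
      then have "0 \<le> real_of_int j * h" using hpos by simp
      then show ?thesis using L_rest[OF \<open>0 \<le> j\<close>] c_bounds \<nu> by simp
    qed (simp add: L_first)
    show "U j \<le> 1"
    proof (cases "j = int N - 1")
      case False
      then have "j \<le> int N - 2" using j J(1) by force
      then show ?thesis using U_rest[of j] c_bounds \<nu> jN[of j] by simp
    qed (simp add: U_last)
  qed
  \<comment> \<open>Since \<open>j < k\<close>, neither the upper end of \<open>j\<close> nor the
    lower end of \<open>k\<close> is truncated, so both explicit formulas apply and \<open>c\<close>
    cancels.\<close>
  show "U j + \<nu> \<le> L k" if jk: "j \<in> set (index_range N q)" "k \<in> set (index_range N q)" "j < k" for j k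
  proof -
    have "-1 \<le> j" "k \<le> int N - 1" using jk J(1) by auto
    moreover have "(real_of_int j + 1) * h \<le> real_of_int k * h"
      using jk(3) hpos by (intro mult_right_mono) linarith+
    ultimately show ?thesis using jk(3) L_rest[of k] U_rest[of j] by simp
  qed
qed

lemma sorted_corner_values:
  assumes "2 \<le> N" "h = 1 / real N" "\<delta> = 1 / (real N)\<^sup>2" "0 < \<nu>" "\<nu> < h" "q \<in> {1..N}"
    and "1 \<le> d" and adm: "lam \<in> admissible d h \<nu>"
  shows "sorted_wrt (<) (corner_values d N h \<delta> \<nu> lam q)"
proof -
  have "sorted_wrt (<) (index_range N q)"
    by (simp add: index_range_def)
  moreover have "(\<Sum>k=1..p-1. lam k) + (h - \<nu>) * (\<Sum>l=p+1..d. lam l) < lam p * \<nu>"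
    if "p \<in> {1..d}" for p
    using adm that by (cases "p = 1") (auto simp: admissible_def numeral_2_eq_2)
  moreover have "0 < lam p" if "p \<in> {1..d}" for p
    using adm that by (auto simp: admissible_def)
  ultimately show ?thesis
    using sorted_row_major_sums[OF _ corner_geometry[OF assms(1-6)],
        where lam = lam and n = d and m = d and A = 0 and B = 0] assms(7)
    unfolding corner_values_def Psi_def by simp
qed

section \<open>Admissibility through tail sums, and the choice of \<nu>\<close>

lemma admissible_of_tail_sums:
  fixes S lam :: "nat \<Rightarrow> real"
  assumes d: "1 \<le> d" and \<nu>: "0 < \<nu>" "\<nu> < h"
    and S1: "S 1 = 1" and Sd: "S (Suc d) = 0"
    and Spos: "\<And>p. p \<in> {1..d} \<Longrightarrow> 0 < S p"
    and lam: "\<And>p. p \<in> {1..d} \<Longrightarrow> lam p = S p - S (Suc p)"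
    and ineq: "\<And>p. p \<in> {1..d} \<Longrightarrow> 1 + h * S (Suc p) < (\<nu> + 1) * S p"
  shows "lam \<in> admissible d h \<nu>"
proof -
  have head: "(\<Sum>k=1..p. lam k) = 1 - S (Suc p)" if "p \<le> d" for p
    using that by (induction p) (auto simp: S1[simplified] lam)
  have tail: "(\<Sum>l=p..d. lam l) = S p" if "p \<in> {1..Suc d}" for p
  proof -
    have "(\<Sum>l=1..d. lam l) = (\<Sum>l=1..p-1. lam l) + (\<Sum>l=p..d. lam l)"
      using that sum.ub_add_nat[of 1 "p - 1" lam "d - (p - 1)"] by (cases "p = 1") auto
    then show ?thesis using head[of d] head[of "p - 1"] that Sd by auto
  qed
  \<comment> \<open>With head sum \<open>1 - S p\<close> and tail sum \<open>S (Suc p)\<close>, the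
    condition rearranges to \<open>ineq\<close>; \<open>S (Suc d) = 0\<close> covers
    \<open>p = d\<close>.\<close>
  have dom: "(\<Sum>k=1..p-1. lam k) + (h - \<nu>) * (\<Sum>l=Suc p..d. lam l) < lam p * \<nu>"
    if "p \<in> {1..d}" for p
  proof -
    have "lam p * \<nu> = S p * \<nu> - S (Suc p) * \<nu>"
      unfolding lam[OF that] by (simp add: left_diff_distrib)
    moreover have "(\<Sum>k=1..p-1. lam k) = 1 - S p"
      using head[of "p - 1"] that by auto
    moreover have "(\<Sum>l=Suc p..d. lam l) = S (Suc p)"
      using tail[of "Suc p"] that by simp
    ultimately show ?thesis
      using ineq[OF that] by (simp add: algebra_simps)
  qed
  have Snonneg: "0 \<le> S (Suc p)" if "p \<in> {1..d}" for p
    using that Spos[of "Suc p"] Sd by (cases "p = d") auto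
  \<comment> \<open>Positivity follows from dominance: once all earlier entries are positive,
    \<open>lam p * \<nu>\<close> exceeds a nonnegative quantity.\<close>
  have pos: "0 < lam p" if "p \<in> {1..d}" for p
    using that
  proof (induction p rule: less_induct)
    case (less p)
    have "0 \<le> (\<Sum>k=1..p-1. lam k)"
      using less by (intro sum_nonneg less_imp_le less.IH) auto
    moreover have "0 \<le> (h - \<nu>) * (\<Sum>l=Suc p..d. lam l)"
      using tail[of "Suc p"] Snonneg less.prems \<nu> by simp
    ultimately have "0 < lam p * \<nu>" using dom[OF less.prems] by linarith
    then show ?case using \<nu> by (simp add: zero_less_mult_iff)
  qed
  show ?thesis
    using pos dom dom[of 1] head[of d] Sd d by (auto simp: admissible_def numeral_2_eq_2)
qed

text \<open>Squaring \<open>2 * \<nu> + (1 - h) = (1 - h) * sqrt X\<close> recovers the quadratic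
  equation. \<open>X > 1\<close> makes \<nu> positive, and the positive right-hand side of the
  equation forces \<open>\<nu> < h\<close>.\<close>

lemma nu_properties:
  fixes h \<nu> :: real
  assumes d: "d \<ge> 2" and h: "0 < h" "h < 1"
    and \<nu>: "\<nu> = - (1 - h) / 2
          + (1 - h) / 2 * sqrt (1 + 4 * h / (1 - h)\<^sup>2 * (1 - (h / (h + 1)) ^ (d - 1)))"
  shows "0 < \<nu>" "\<nu> < h" "h - \<nu> < (h / (\<nu> + 1)) ^ d"
proof -
  define r where "r = h / (h + 1)"
  define X where "X = 1 + 4 * h / (1 - h)\<^sup>2 * (1 - r ^ (d - 1))"
  have r: "0 < r" "r < 1" using h by (auto simp: r_def)
  have "r ^ (d - 1) < 1" using r d by (simp add: power_less_one_iff)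
  then have "0 < 4 * h / (1 - h)\<^sup>2 * (1 - r ^ (d - 1))" using h by simp
  then have X: "1 < X" by (simp add: X_def)
  have \<nu>X: "2 * \<nu> + (1 - h) = (1 - h) * sqrt X"
    unfolding \<nu> X_def r_def by (simp add: field_simps)
  have "(1 - h) * 1 < (1 - h) * sqrt X" using h X by (intro mult_strict_left_mono) auto
  with \<nu>X show \<nu>pos: "0 < \<nu>" by simp
  have "(2 * \<nu> + (1 - h))\<^sup>2 = (1 - h)\<^sup>2 * X"
    unfolding \<nu>X using X by (simp add: power_mult_distrib)
  also have "\<dots> = (1 - h)\<^sup>2 + 4 * h * (1 - r ^ (d - 1))"
    using h by (simp add: X_def distrib_left)
  finally have quad: "(\<nu> + 1) * (h - \<nu>) = h * r ^ (d - 1)"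
    by (simp add: power2_eq_square algebra_simps)
  have "0 < (\<nu> + 1) * (h - \<nu>)" unfolding quad using h r by simp
  then show \<nu>h: "\<nu> < h" using \<nu>pos by (simp add: zero_less_mult_iff)
  \<comment> \<open>Dividing \<open>quad\<close> by \<open>\<nu> + 1\<close> leaves one factor
    \<open>h / (\<nu> + 1)\<close> and \<open>d - 1\<close> factors \<open>r\<close>. Enlarging each
    \<open>r\<close> gives the strict bound, as \<open>d - 1\<close> is positive.\<close>
  have "r < h / (\<nu> + 1)" using h \<nu>pos \<nu>h by (simp add: r_def frac_less2)
  then have "r ^ (d - 1) < (h / (\<nu> + 1)) ^ (d - 1)"
    using r d by (intro power_strict_mono) auto
  moreover have "h - \<nu> = h / (\<nu> + 1) * r ^ (d - 1)"
    using quad \<nu>pos by (simp add: field_simps)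
  moreover have "0 < h / (\<nu> + 1)" using h \<nu>pos by simp
  ultimately have "h - \<nu> < h / (\<nu> + 1) * (h / (\<nu> + 1)) ^ (d - 1)"
    by (simp only: mult_strict_left_mono)
  then show "h - \<nu> < (h / (\<nu> + 1)) ^ d"
    using d by (cases d) simp_all
qed

section \<open>Closed forms for the recursions, and conclusion\<close>

theorem theorem3p1:
  fixes d N :: nat and h \<delta> \<nu> :: real and Q S lam \<chi> :: "nat \<Rightarrow> real"
  assumes "d \<ge> 2" and "N \<ge> 2"
    and "0 < h" and "h < 1"
    and "h = 1 / real N" and "\<delta> = 1 / (real N)\<^sup>2"
    and "\<nu> = - (1 - h) / 2
          + (1 - h) / 2 * sqrt (1 + 4 * h / (1 - h)\<^sup>2 * (1 - (h / (h + 1)) ^ (d - 1)))"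
    and "Q d = 1 / (\<nu> + 1)"
    and "\<And>p. 1 \<le> p \<Longrightarrow> p \<le> d - 1 \<Longrightarrow> Q p = h / (\<nu> + 1) * Q (p + 1) + 1 / (\<nu> + 1)"
    and "S 1 = 1"
    and "\<And>p. 1 \<le> p \<Longrightarrow> p \<le> d - 1 \<Longrightarrow> S (p + 1) = 1 / 2 * (Q (p + 1) + (\<nu> + 1) / h * S p - 1 / h)"
    and "\<And>p. 1 \<le> p \<Longrightarrow> p \<le> d - 1 \<Longrightarrow> lam p = S p - S (p + 1)"
    and "lam d = S d"
    and "\<And>p. 1 \<le> p \<Longrightarrow> p \<le> d - 1 \<Longrightarrow> \<chi> p = (2 * h - \<nu> - 1) / (2 * h)"
    and "\<chi> d = 1"
  shows "\<nu> \<in> {0<..<h} \<and> lam \<in> admissible d h \<nu>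
    \<and> (\<forall>p\<in>{1..d}. lam p =
         h ^ (d - p) / (\<nu> + 1) ^ (d - p + 1)
         + \<chi> p * ((\<nu> - h + (h / (\<nu> + 1)) ^ d) / (\<nu> + 1 - h)) * ((\<nu> + 1) / (2 * h)) ^ (p - 1))
    \<and> (\<forall>q\<in>{1..N}. sorted_wrt (<) (corner_values d N h \<delta> \<nu> lam q))"
proof -
  have d: "2 \<le> d" "1 \<le> d" and h: "0 < h" "h < 1" using assms by auto
  note \<nu> = nu_properties[OF assms(1,3,4,7)]
  define a where "a = h / (\<nu> + 1)"
  define b where "b = (\<nu> + 1) / (2 * h)"
  define D where "D = \<nu> + 1 - h"
  define C where "C = (\<nu> - h + a ^ d) / D"
  have D: "0 < D" using \<nu> h by (simp add: D_def)
  have C: "0 < C" using \<nu>(3) D by (simp add: C_def a_def)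
  have a: "0 < a" and a1: "1 - a = D / (\<nu> + 1)" and ah: "(\<nu> + 1) * a = h"
    using \<nu> h by (auto simp: a_def D_def field_simps)
  have b: "0 < b" and bh: "2 * (h * b) = \<nu> + 1"
    using \<nu> h by (auto simp: b_def field_simps)

  have Qrec: "(\<nu> + 1) * Q p = h * Q (Suc p) + 1" if "1 \<le> p" "p < d" for p
  proof -
    have "Q p = (h * Q (Suc p) + 1) / (\<nu> + 1)"
      using assms(9)[of p] that by (simp add: add_divide_distrib)
    then show ?thesis using \<nu>(1) by simp
  qed
  \<comment> \<open>The affine recursion has ratio \<open>a\<close> and fixed point
    \<open>1 / D\<close>. Descending from \<open>d\<close>, it starts as if the value at
    \<open>d + 1\<close> were 0.\<close>
  have Q: "Q p = (1 - a ^ (Suc d - p)) / D" if "p \<in> {1..d}" for p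
  proof -
    from that have "p \<le> d" "1 \<le> p" by auto
    then show ?thesis
    proof (induction p rule: inc_induct)
      case base
      then show ?case using D by (simp add: a1 assms(8))
    next
      case (step p)
      have "(\<nu> + 1) * Q p = h * Q (Suc p) + 1"
        using Qrec step by simp
      also have "\<dots> = (h * (1 - a ^ (d - p)) + D) / D"
      proof -
        have "Q (Suc p) = (1 - a ^ (d - p)) / D" using step by simp
        then show ?thesis using D by (simp add: add_divide_distrib)
      qed
      also have "h * (1 - a ^ (d - p)) + D = (\<nu> + 1) * (1 - a ^ (Suc d - p))"
      proof -
        have "Suc d - p = Suc (d - p)" using step by simp
        then have "(\<nu> + 1) * a ^ (Suc d - p) = h * a ^ (d - p)"
          by (simp add: ah[symmetric])
        then show ?thesis by (simp add: D_def algebra_simps)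
      qed
      finally have "(\<nu> + 1) * Q p = (\<nu> + 1) * ((1 - a ^ (Suc d - p)) / D)" by simp
      then show ?case
        using \<nu>(1) by (subst (asm) mult_cancel_left) simp
    qed
  qed
  have Q1: "1 - Q 1 = C"
    using Q[of 1] d D by (simp add: C_def D_def field_simps)
  \<comment> \<open>\<open>Q\<close> also solves the recursion for \<open>S\<close>, because
    \<open>2 * b * Q p = Q (p + 1) + 1 / h\<close>. Hence \<open>S - Q\<close> is multiplied by
    \<open>b\<close> at each step, starting from \<open>1 - Q 1 = C\<close>.\<close>
  have S: "S p = Q p + C * b ^ (p - 1)" if "p \<in> {1..d}" for p
  proof -
    from that have "1 \<le> p" "p \<le> d" by auto
    then show ?thesis
    proof (induction p rule: dec_induct)
      case base
      then show ?case using assms(10) Q1 by simp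
    next
      case (step p)
      have Qp: "Q p = a * Q (p + 1) + 1 / (\<nu> + 1)"
        using assms(9)[of p] step by (simp add: a_def)
      have b2: "(\<nu> + 1) / h = 2 * b" "2 * b * a = 1" "2 * b / (\<nu> + 1) = 1 / h"
        using h \<nu>(1) by (auto simp: a_def b_def divide_simps)
      have "2 * b * Q p = (2 * b * a) * Q (p + 1) + 2 * b / (\<nu> + 1)"
        unfolding Qp by (simp add: algebra_simps)
      then have bQ: "2 * b * Q p = Q (p + 1) + 1 / h"
        by (simp add: b2)
      have "S (p + 1) = 1 / 2 * (Q (p + 1) + 2 * b * S p - 1 / h)"
        using assms(11)[of p] step by (simp add: b2)
      also have "2 * b * S p = Q (p + 1) + 1 / h + 2 * (b * (C * b ^ (p - 1)))"
        using step bQ by (simp add: algebra_simps)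
      also have "b * (C * b ^ (p - 1)) = C * b ^ p"
        using step by (cases p) auto
      finally show ?case by simp
    qed
  qed

  \<comment> \<open>\<open>S\<close> is unconstrained beyond \<open>d\<close>; extending it by 0
    lets \<open>p = d\<close> be treated like the other indices.\<close>
  define T where "T p = (if p \<le> d then S p else 0)" for p
  have lam: "lam p = T p - T (Suc p)" if "p \<in> {1..d}" for p
    using that assms(12)[of p] assms(13) by (cases "p = d") (auto simp: T_def)
  have Spos: "0 < S p" if "p \<in> {1..d}" for p
  proof -
    have "a < 1" using a1 D \<nu>(1) by (simp add: a_def D_def)
    then have "a ^ (Suc d - p) \<le> 1" using a by (simp add: power_le_one)
    then have "0 \<le> Q p" using Q[OF that] D by simp
    then show ?thesis using S[OF that] C b by (simp add: add_nonneg_pos)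
  qed
  have ineq: "1 + h * T (Suc p) < (\<nu> + 1) * T p" if p: "p \<in> {1..d}" for p
  proof -
    have pert: "0 < (\<nu> + 1) * (C * b ^ (p - 1))"
      using \<nu>(1) C b by simp
    show ?thesis
    proof (cases "p = d")
      case True
      have "(\<nu> + 1) * Q d = 1" using assms(8) \<nu>(1) by simp
      then show ?thesis using True S[OF p] pert by (simp add: T_def distrib_left)
    next
      case False
      have "(\<nu> + 1) * Q p = h * Q (Suc p) + 1"
        using Qrec p False by simp
      \<comment> \<open>The perturbation enters the right side of \<open>ineq\<close> with twice its
        weight on the left.\<close>
      moreover have "2 * (h * (C * b ^ p)) = (\<nu> + 1) * (C * b ^ (p - 1))"
        using p by (cases p) (auto simp: bh[symmetric])
      with pert have "h * (C * b ^ p) < (\<nu> + 1) * (C * b ^ (p - 1))" by linarith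
      ultimately show ?thesis
        using S[of p] S[of "Suc p"] p False pert by (simp add: T_def distrib_left)
    qed
  qed
  have adm: "lam \<in> admissible d h \<nu>"
    by (rule admissible_of_tail_sums[where S = T])
      (use d \<nu> lam ineq Spos assms(10) in \<open>auto simp: T_def\<close>)

  have formula: "lam p = h ^ (d - p) / (\<nu> + 1) ^ (d - p + 1)
         + \<chi> p * ((\<nu> - h + (h / (\<nu> + 1)) ^ d) / (\<nu> + 1 - h)) * ((\<nu> + 1) / (2 * h)) ^ (p - 1)"
    if p: "p \<in> {1..d}" for p
  proof -
    have geo: "h ^ (d - p) / (\<nu> + 1) ^ (d - p + 1) = a ^ (d - p) / (\<nu> + 1)"
      by (simp add: a_def power_divide)
    have "lam p = a ^ (d - p) / (\<nu> + 1) + \<chi> p * C * b ^ (p - 1)"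
    proof (cases "p = d")
      case True
      then show ?thesis using S[OF p] assms(8,13,15) by simp
    next
      case False
      then have pd: "1 \<le> p" "p \<le> d - 1" using p by auto
      have "Suc d - p = Suc (d - p)" using p by auto
      then have "Q p - Q (Suc p) = a ^ (d - p) * (1 - a) / D"
        using Q[of p] Q[of "Suc p"] p False by (simp add: diff_divide_distrib[symmetric] algebra_simps)
      then have "Q p - Q (Suc p) = a ^ (d - p) / (\<nu> + 1)"
        using D by (simp add: a1)
      \<comment> \<open>The difference of perturbations produces the factor \<open>1 - b\<close>. At
        \<open>p = d\<close> nothing is subtracted, which is why
        \<open>\<chi> d = 1\<close>.\<close>
      moreover have "C * b ^ (p - 1) - C * b ^ p = \<chi> p * C * b ^ (p - 1)"
      proof -
        have \<chi>: "\<chi> p = 1 - b" using assms(14)[OF pd] h by (simp add: b_def diff_divide_distrib add_divide_distrib)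
        show ?thesis unfolding \<chi> using p by (cases p) (auto simp: algebra_simps)
      qed
      ultimately show ?thesis
        using assms(12)[OF pd] S[of p] S[of "Suc p"] p False by simp
    qed
    then show ?thesis unfolding geo C_def a_def b_def D_def .
  qed

  show ?thesis
    using \<nu> adm formula sorted_corner_values[OF assms(2,5,6) \<nu>(1,2) _ d(2) adm] by auto
qed

end
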